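(* Let $X$ be a Banach space whose dual $X^*$ is separable, and let $1<p<\infty$. Then every linear subspace $E$ of $\mathcal B(X,\ell_p)$ that contains $\mathcal F(X,\ell_p)$ (with the operator norm) has the UBCP.
   Context: $\mathcal B(X,Y)$ is the space of bounded linear operators from $X$ to $Y$ with the operator norm, and $\mathcal F(X,Y)$ is its subspace of finite rank operators. A normed space $Z$ has the uniform ball-covering property (UBCP) if its unit sphere $S_Z=\{z:\|z\|=1\}$ can be covered by countably many balls $\{B_n\}$, none of which contains the origin, with bounded radii, and for which there exists an open ball $B_0$ containing the origin with $B_n\cap B_0=\emptyset$ for all $n$. *)

theory Defs
  imports "HOL-Analysis.Analysis" "HOL-Library.Function_Algebras"
begin

text \<open>
  The scalar field \<open>'k\<close> is a complete real normed field. By the Gelfand--Mazur theorem this means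
  that \<open>'k\<close> is \<open>\<real>\<close> or \<open>\<complex>\<close> up to isomorphism, so both cases are treated at once. A Banach space over
  \<open>'k\<close> is given by its underlying real Banach space \<open>'a\<close> and the multiplication by scalars in \<open>'k\<close>.
\<close>

locale banach_over = vector_space sc
  for sc :: "'k::{real_normed_field, banach} \<Rightarrow> 'a::banach \<Rightarrow> 'a" +
  assumes norm_scale: "norm (sc c x) = norm c * norm x"
    and scale_of_real: "sc (of_real r) x = r *\<^sub>R x"

lemma banach_over_scaleR: "banach_over (scaleR :: real \<Rightarrow> 'a::banach \<Rightarrow> 'a)"
  by unfold_locales (auto simp: algebra_simps)

lemma banach_over_times: "banach_over ((*) :: 'k::{real_normed_field, banach} \<Rightarrow> 'k \<Rightarrow> 'k)"
  by unfold_locales (auto simp: algebra_simps norm_mult scaleR_conv_of_real)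

text \<open>
  The type \<open>'a \<Rightarrow>\<^sub>L 'k\<close> consists of the bounded real-linear maps and carries the operator norm; the
  dual is the subset of those that are linear over \<open>'k\<close>.
\<close>

definition dual :: "('k::{real_normed_field, banach} \<Rightarrow> 'a::banach \<Rightarrow> 'a) \<Rightarrow> ('a \<Rightarrow>\<^sub>L 'k) set"
  where "dual sc = {f. Vector_Spaces.linear sc (*) (blinfun_apply f)}"

definition ell :: "real \<Rightarrow> (nat \<Rightarrow> 'k::real_normed_vector) set"
  where "ell p = {y. summable (\<lambda>n. norm (y n) powr p)}"

definition ell_norm :: "real \<Rightarrow> (nat \<Rightarrow> 'k::real_normed_vector) \<Rightarrow> real"
  where "ell_norm p y = (\<Sum>n. norm (y n) powr p) powr (1 / p)"

definition seq_scale :: "'k::times \<Rightarrow> (nat \<Rightarrow> 'k) \<Rightarrow> nat \<Rightarrow> 'k"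
  where "seq_scale c y = (\<lambda>n. c * y n)"

definition op_scale :: "'k::times \<Rightarrow> ('a \<Rightarrow> nat \<Rightarrow> 'k) \<Rightarrow> 'a \<Rightarrow> nat \<Rightarrow> 'k"
  where "op_scale c T = (\<lambda>x. seq_scale c (T x))"

lemma vector_space_seq_scale: "vector_space (seq_scale :: 'k::field \<Rightarrow> _)"
  by unfold_locales (auto simp: seq_scale_def fun_eq_iff algebra_simps)

lemma vector_space_op_scale: "vector_space (op_scale :: 'k::field \<Rightarrow> ('a \<Rightarrow> nat \<Rightarrow> 'k) \<Rightarrow> _)"
  by unfold_locales (auto simp: op_scale_def seq_scale_def fun_eq_iff algebra_simps)

definition bounded_ops ::
    "('k::{real_normed_field, banach} \<Rightarrow> 'a::banach \<Rightarrow> 'a) \<Rightarrow> real \<Rightarrow> ('a \<Rightarrow> nat \<Rightarrow> 'k) set"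
  where "bounded_ops sc p =
    {T. Vector_Spaces.linear sc seq_scale T \<and> range T \<subseteq> ell p \<and>
        (\<exists>C. \<forall>x. ell_norm p (T x) \<le> C * norm x)}"

definition finite_rank_ops ::
    "('k::{real_normed_field, banach} \<Rightarrow> 'a::banach \<Rightarrow> 'a) \<Rightarrow> real \<Rightarrow> ('a \<Rightarrow> nat \<Rightarrow> 'k) set"
  where "finite_rank_ops sc p =
    {T \<in> bounded_ops sc p. \<exists>B. finite B \<and> range T \<subseteq> module.span seq_scale B}"

definition op_norm :: "real \<Rightarrow> ('a::real_normed_vector \<Rightarrow> nat \<Rightarrow> 'k::real_normed_vector) \<Rightarrow> real"
  where "op_norm p T = (SUP x\<in>{x. norm x \<le> 1}. ell_norm p (T x))"

text \<open>
  A normed space is given here by a carrier \<open>Z\<close>, a linear subspace of an ambient vector space, and a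
  norm \<open>N\<close> on it.
\<close>

definition nball :: "'z::ab_group_add set \<Rightarrow> ('z \<Rightarrow> real) \<Rightarrow> 'z \<Rightarrow> real \<Rightarrow> 'z set"
  where "nball Z N c r = {z \<in> Z. N (z - c) < r}"

text \<open>
  The family of balls is a countable set of pairs of a centre and a radius, rather than a sequence,
  because for the zero space, whose unit sphere is empty, only the empty family qualifies.
  All balls are open. Closed balls give the same property: an open set disjoint from an open ball is
  disjoint from the closed ball, and conversely the radii can be enlarged slightly while \<open>B\<^sub>0\<close> is
  shrunk.
\<close>

definition UBCP :: "'z::ab_group_add set \<Rightarrow> ('z \<Rightarrow> real) \<Rightarrow> bool"
  where "UBCP Z N \<longleftrightarrow>
    (\<exists>\<B>. countable \<B> \<and>
      (\<forall>(c, r)\<in>\<B>. c \<in> Z \<and> 0 < r) \<and>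
      {z \<in> Z. N z = 1} \<subseteq> (\<Union>(c, r)\<in>\<B>. nball Z N c r) \<and>
      (\<forall>(c, r)\<in>\<B>. 0 \<notin> nball Z N c r) \<and>
      (\<exists>R. \<forall>(c, r)\<in>\<B>. r \<le> R) \<and>
      (\<exists>c\<^sub>0\<in>Z. \<exists>r\<^sub>0>0. 0 \<in> nball Z N c\<^sub>0 r\<^sub>0 \<and>
        (\<forall>(c, r)\<in>\<B>. nball Z N c r \<inter> nball Z N c\<^sub>0 r\<^sub>0 = {})))"

end

theory Submission
  imports Defs
begin

text \<open>
  Let \<open>P\<^sub>n\<close> be the projection onto the first \<open>n\<close> coordinates. Flipping the sign of these coordinates
  is an isometry of \<open>\<ell>\<^sub>p\<close>, so \<open>\<parallel>T - 2 P\<^sub>n T\<parallel> = \<parallel>T\<parallel> = 1\<close>, while \<open>\<parallel>2 P\<^sub>n T\<parallel>\<close> is close to \<open>2\<close> for large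
  \<open>n\<close>. Perturbing the rows of \<open>2 P\<^sub>n T\<close> into a countable dense subset of the dual gives a centre \<open>S\<close>
  from a countable set of finite rank operators with \<open>\<parallel>T - S\<parallel> < \<parallel>S\<parallel> - 1/4\<close>.
\<close>

section \<open>The sequence space\<close>

lemma ell_norm_nonneg: "0 \<le> ell_norm p y"
  by (simp add: ell_norm_def)

lemma ell_norm_powr:
  assumes "0 < p" "y \<in> ell p"
  shows "ell_norm p y powr p = (\<Sum>n. norm (y n) powr p)"
  using assms by (simp add: ell_norm_def ell_def powr_powr suminf_nonneg)

lemma ell_norm_leI:
  assumes "0 < p" "y \<in> ell p" "0 \<le> c" "(\<Sum>n. norm (y n) powr p) \<le> c powr p"
  shows "ell_norm p y \<le> c"
proof -
  have "ell_norm p y \<le> (c powr p) powr (1 / p)"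
    unfolding ell_norm_def using assms
    by (intro powr_mono2) (auto simp: ell_def intro!: suminf_nonneg)
  then show ?thesis using assms by (simp add: powr_powr)
qed

lemma norm_le_ell_norm:
  assumes "0 < p" "y \<in> ell p"
  shows "norm (y i) \<le> ell_norm p y"
proof -
  have "norm (y i) powr p \<le> (\<Sum>n. norm (y n) powr p)"
    using sum_le_suminf[of "\<lambda>n. norm (y n) powr p" "{i}"] assms by (simp add: ell_def)
  then have "(norm (y i) powr p) powr (1 / p) \<le> ell_norm p y"
    unfolding ell_norm_def using assms by (intro powr_mono2) auto
  then show ?thesis using assms by (simp add: powr_powr)
qed

lemma ell_norm_eq_0:
  assumes "0 < p" "y \<in> ell p" "ell_norm p y = 0"
  shows "y = 0"
  using norm_le_ell_norm[OF assms(1,2)] assms(3) by (auto simp: fun_eq_iff)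

lemma ell_finite_support:
  assumes "\<And>i. n \<le> i \<Longrightarrow> y i = 0"
  shows "y \<in> ell p"
  unfolding ell_def mem_Collect_eq
  by (rule summable_finite[of "{..<n}"]) (use assms in \<open>auto simp: not_less\<close>)

text \<open>Termwise comparison of the series. Its use is that changing signs of coordinates stays
  in \<open>ell p\<close> and does not increase the norm.\<close>

lemma ell_mono:
  assumes "0 < p" "z \<in> ell p" "\<And>i. norm (y i) \<le> norm (z i)"
  shows "y \<in> ell p" "ell_norm p y \<le> ell_norm p z"
proof -
  have le: "norm (y i) powr p \<le> norm (z i) powr p" for i
    using assms by (intro powr_mono2) auto
  have z: "summable (\<lambda>n. norm (z n) powr p)" using assms by (simp add: ell_def)
  then have y: "summable (\<lambda>n. norm (y n) powr p)"
    by (rule summable_comparison_test') (use le in auto)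
  then show "y \<in> ell p" by (simp add: ell_def)
  show "ell_norm p y \<le> ell_norm p z"
    unfolding ell_norm_def using le y z assms
    by (intro powr_mono2 suminf_le suminf_nonneg) auto
qed

section \<open>Convexity of the power function and Minkowski's inequality\<close>

lemma powr_convex_combination:
  fixes p s t u v :: real
  assumes "1 \<le> p" "0 \<le> s" "0 \<le> t" "0 < u" "0 < v" "u + v = 1"
  shows "(u * s + v * t) powr p \<le> u * s powr p + v * t powr p"
proof -
  \<comment> \<open>Settles the cases where \<open>s\<close> or \<open>t\<close> is 0, since
    \<open>w powr p \<le> w\<close> for \<open>0 < w \<le> 1\<close>. For positive \<open>s\<close>
    and \<open>t\<close> the claim is the convexity of \<open>x powr p\<close>.\<close>
  have aux: "(w * r) powr p \<le> w * r powr p" if "0 < w" "w \<le> 1" "0 \<le> r" for w r :: real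
  proof -
    have "w powr p \<le> w powr 1" using that assms by (intro powr_mono') auto
    then show ?thesis using that by (simp add: powr_mult mult_right_mono)
  qed
  consider "s = 0" | "t = 0" | "0 < s" "0 < t" using assms by linarith
  then show ?thesis
  proof cases
    case 3
    then show ?thesis
      using convex_onD[OF powr_convex[OF assms(1)], of v s t] assms
      by (simp add: algebra_simps flip: eq_diff_eq)
  qed (use assms aux[of v t] aux[of u s] in auto)
qed

text \<open>Minkowski by normalisation: with \<open>a\<close>, \<open>b\<close> the norms of
  \<open>y\<close>, \<open>z\<close>, the norm of \<open>y n + z n\<close> is at most
  \<open>a + b\<close> times a convex combination of \<open>norm (y n) / a\<close> and
  \<open>norm (z n) / b\<close>. Convexity bounds its power termwise by \<open>?g n\<close>, and
  \<open>?g\<close> sums to \<open>(a + b) powr p\<close> because both normalised series sum to 1.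
  Zero norms are split off since they cannot be divided by.\<close>

lemma ell_norm_triangle:
  fixes y z :: "nat \<Rightarrow> 'k::real_normed_vector"
  assumes p: "1 \<le> p" and y: "y \<in> ell p" and z: "z \<in> ell p"
  shows "y + z \<in> ell p" "ell_norm p (y + z) \<le> ell_norm p y + ell_norm p z"
proof -
  define a b where "a = ell_norm p y" and "b = ell_norm p z"
  have "y + z \<in> ell p \<and> ell_norm p (y + z) \<le> a + b"
  proof (cases "a = 0 \<or> b = 0")
    case True
    then have "y = 0 \<or> z = 0" using ell_norm_eq_0[of p] p y z by (auto simp: a_def b_def)
    then show ?thesis using y z ell_norm_nonneg[of p] by (auto simp: a_def b_def)
  next
    case False
    then have ab: "0 < a" "0 < b"
      using ell_norm_nonneg[of p y] ell_norm_nonneg[of p z] by (auto simp: a_def b_def)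
    let ?g = "\<lambda>n. (a + b) powr p * (a / (a + b) * (norm (y n) powr p / a powr p)
      + b / (a + b) * (norm (z n) powr p / b powr p))"
    have le: "norm ((y + z) n) powr p \<le> ?g n" for n
    proof -
      have "norm (y n + z n) \<le>
          (a + b) * (a / (a + b) * (norm (y n) / a) + b / (a + b) * (norm (z n) / b))"
        using ab norm_triangle_ineq[of "y n" "z n"] by (simp add: distrib_left)
      then have "norm (y n + z n) powr p \<le>
          ((a + b) * (a / (a + b) * (norm (y n) / a) + b / (a + b) * (norm (z n) / b))) powr p"
        using p by (intro powr_mono2) auto
      also have "\<dots> = (a + b) powr p *
          (a / (a + b) * (norm (y n) / a) + b / (a + b) * (norm (z n) / b)) powr p"
        using ab by (intro powr_mult)
      also have "\<dots> \<le> (a + b) powr p *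
          (a / (a + b) * (norm (y n) / a) powr p + b / (a + b) * (norm (z n) / b) powr p)"
        using ab p by (intro mult_left_mono powr_convex_combination)
          (auto simp: add_divide_distrib[symmetric])
      also have "\<dots> = ?g n" using ab by (simp add: powr_divide)
      finally show ?thesis by simp
    qed
    have "(\<lambda>n. norm (y n) powr p) sums a powr p" "(\<lambda>n. norm (z n) powr p) sums b powr p"
      using ell_norm_powr[of p y] ell_norm_powr[of p z] p y z
      by (auto simp: a_def b_def ell_def sums_iff)
    then have "?g sums ((a + b) powr p * (a / (a + b) * (a powr p / a powr p)
        + b / (a + b) * (b powr p / b powr p)))"
      by (intro sums_mult sums_add sums_divide)
    also have "(a + b) powr p * (a / (a + b) * (a powr p / a powr p)
        + b / (a + b) * (b powr p / b powr p)) = (a + b) powr p"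
      using ab by (simp add: add_divide_distrib[symmetric])
    finally have g: "?g sums (a + b) powr p" .
    have s: "summable (\<lambda>n. norm ((y + z) n) powr p)"
      using sums_summable[OF g] by (rule summable_comparison_test') (use le in auto)
    then have "y + z \<in> ell p" by (simp add: ell_def)
    moreover have "(\<Sum>n. norm ((y + z) n) powr p) \<le> (a + b) powr p"
      using suminf_le[OF le s sums_summable[OF g]] sums_unique[OF g] by simp
    ultimately show ?thesis using ell_norm_leI[of p "y + z" "a + b"] p ab by auto
  qed
  then show "y + z \<in> ell p" "ell_norm p (y + z) \<le> ell_norm p y + ell_norm p z"
    by (auto simp: a_def b_def)
qed

lemma ell_norm_diff:
  fixes y z :: "nat \<Rightarrow> 'k::real_normed_vector"
  assumes "1 \<le> p" "y \<in> ell p" "z \<in> ell p"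
  shows "y - z \<in> ell p" "ell_norm p (y - z) \<le> ell_norm p y + ell_norm p z"
proof -
  have "- z \<in> ell p" "ell_norm p (- z) = ell_norm p z"
    using assms by (simp_all add: ell_def ell_norm_def)
  then show "y - z \<in> ell p" "ell_norm p (y - z) \<le> ell_norm p y + ell_norm p z"
    using ell_norm_triangle[of p y "- z"] assms by simp_all
qed

section \<open>The projections onto the first \<open>n\<close> coordinates\<close>

definition trunc :: "nat \<Rightarrow> (nat \<Rightarrow> 'k::zero) \<Rightarrow> nat \<Rightarrow> 'k"
  where "trunc n y = (\<lambda>i. if i < n then y i else 0)"

lemma trunc_in_ell: "trunc n y \<in> ell p"
  by (rule ell_finite_support[of n]) (simp add: trunc_def)

text \<open>A crude bound by the sum norm, from splitting off one coordinate \<open>?e\<close> at a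
  time. It suffices for bounding operators with finitely many rows and for adding up the errors made
  in the rows.\<close>

lemma ell_norm_trunc_le:
  fixes y :: "nat \<Rightarrow> 'k::real_normed_vector"
  assumes "1 \<le> p"
  shows "ell_norm p (trunc n y) \<le> (\<Sum>i<n. norm (y i))"
proof (induction n)
  case 0
  then show ?case by (simp add: trunc_def ell_norm_def)
next
  case (Suc n)
  let ?e = "\<lambda>i. if i = n then y n else 0"
  have e: "?e \<in> ell p" by (rule ell_finite_support[of "Suc n"]) auto
  have "(\<lambda>i. norm (?e i) powr p) = (\<lambda>i. if i = n then norm (y n) powr p else 0)" by auto
  then have "ell_norm p ?e = norm (y n)"
    using assms sums_unique[OF sums_single[of n "\<lambda>_. norm (y n) powr p"]]
    by (simp add: ell_norm_def powr_powr)
  moreover have "trunc (Suc n) y = trunc n y + ?e" by (auto simp: trunc_def fun_eq_iff less_Suc_eq)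
  ultimately show ?case
    using ell_norm_triangle(2)[OF assms trunc_in_ell e, of n y] Suc.IH
    by (simp del: plus_fun_apply)
qed

text \<open>The truncated norms are \<open>1 / p\<close>-th powers of the partial sums.\<close>

lemma ell_norm_trunc_tendsto:
  assumes "0 < p" "y \<in> ell p"
  shows "(\<lambda>n. ell_norm p (trunc n y)) \<longlonglongrightarrow> ell_norm p y"
proof -
  have "(\<Sum>i. norm (trunc n y i) powr p) = (\<Sum>i<n. norm (y i) powr p)" for n
    by (subst suminf_finite[of "{..<n}"]) (auto simp: trunc_def)
  moreover have "(\<lambda>n. \<Sum>i<n. norm (y i) powr p) \<longlonglongrightarrow> (\<Sum>i. norm (y i) powr p)"
    using assms by (intro summable_LIMSEQ) (simp add: ell_def)
  ultimately show ?thesis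
    unfolding ell_norm_def using assms
    by (auto intro!: tendsto_powr2 tendsto_const eventuallyI sum_nonneg)
qed

section \<open>Operators into the sequence space\<close>

lemma sum_apply:
  fixes f :: "'i \<Rightarrow> 'b \<Rightarrow> 'c::comm_monoid_add"
  shows "(\<Sum>i\<in>I. f i) x = (\<Sum>i\<in>I. f i x)"
  by (induction I rule: infinite_finite_induct) auto

lemma bounded_opsD:
  assumes "T \<in> bounded_ops sc p"
  shows "T x \<in> ell p" "T (x + y) = T x + T y" "T (sc c x) = seq_scale c (T x)"
proof -
  interpret Vector_Spaces.linear sc seq_scale T using assms by (simp add: bounded_ops_def)
  show "T x \<in> ell p" "T (x + y) = T x + T y" "T (sc c x) = seq_scale c (T x)"
    using assms by (auto simp: bounded_ops_def add scale)
qed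

lemma op_norm_upper:
  assumes "T \<in> bounded_ops sc p" "norm x \<le> 1"
  shows "ell_norm p (T x) \<le> op_norm p T"
proof -
  obtain C where C: "\<And>x. ell_norm p (T x) \<le> C * norm x"
    using assms by (auto simp: bounded_ops_def)
  \<comment> \<open>\<open>C\<close> may be negative, so the bound on the unit ball is
    \<open>\<bar>C\<bar>\<close>.\<close>
  have "ell_norm p (T x) \<le> \<bar>C\<bar>" if "norm x \<le> 1" for x
  proof -
    have "C * norm x \<le> \<bar>C\<bar> * 1" using that by (intro mult_mono) auto
    with C[of x] show ?thesis by simp
  qed
  then show ?thesis
    unfolding op_norm_def using assms by (intro cSUP_upper bdd_aboveI2[of _ _ "\<bar>C\<bar>"]) auto
qed

lemma op_norm_least:
  assumes "\<And>x. norm x \<le> 1 \<Longrightarrow> ell_norm p (T x) \<le> C"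
  shows "op_norm p T \<le> C"
  unfolding op_norm_def using assms by (intro cSUP_least) (auto intro: exI[of _ 0])

text \<open>Differences suit the later use: \<open>S = T - (T - S)\<close> bounds the norm of a
  centre \<open>S\<close> by those of \<open>T\<close> and \<open>T - S\<close>.\<close>

lemma op_norm_diff:
  assumes "1 \<le> p" "S \<in> bounded_ops sc p" "T \<in> bounded_ops sc p"
  shows "op_norm p (S - T) \<le> op_norm p S + op_norm p T"
proof (rule op_norm_least)
  fix x :: 'a assume "norm x \<le> 1"
  then show "ell_norm p ((S - T) x) \<le> op_norm p S + op_norm p T"
    using ell_norm_diff(2)[OF assms(1), of "S x" "T x"] assms(2,3)
      op_norm_upper[of S sc p x] op_norm_upper[of T sc p x]
    by (auto simp: bounded_opsD)
qed

section \<open>Finite rank operators given by their rows, and the choice of a centre\<close>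

definition op_of_rows :: "('a::real_normed_vector \<Rightarrow>\<^sub>L 'k::real_normed_vector) list \<Rightarrow> 'a \<Rightarrow> nat \<Rightarrow> 'k"
  where "op_of_rows fs x = trunc (length fs) (\<lambda>i. blinfun_apply (fs ! i) x)"

text \<open>The row norms add up to a bound for the operator, and the first \<open>length fs\<close>
  unit vectors span its range.\<close>

lemma op_of_rows_finite_rank:
  fixes sc :: "'k::{real_normed_field, banach} \<Rightarrow> 'a::banach \<Rightarrow> 'a"
  assumes sc: "banach_over sc" and p: "1 \<le> p" and fs: "set fs \<subseteq> dual sc"
  shows "op_of_rows fs \<in> finite_rank_ops sc p"
proof -
  interpret banach_over sc by (fact sc)
  interpret q: vector_space "seq_scale :: 'k \<Rightarrow> _" by (rule vector_space_seq_scale)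
  have row: "Vector_Spaces.linear sc (*) (blinfun_apply (fs ! i))" if "i < length fs" for i
    using that fs nth_mem by (fastforce simp: dual_def)
  have "Vector_Spaces.linear sc seq_scale (op_of_rows fs)"
    unfolding Vector_Spaces.linear_iff
    using vector_space_axioms q.vector_space_axioms row
    by (auto simp: op_of_rows_def trunc_def seq_scale_def fun_eq_iff Vector_Spaces.linear_iff blinfun.add_right)
  moreover have "range (op_of_rows fs) \<subseteq> ell p"
    by (auto simp: op_of_rows_def trunc_in_ell)
  moreover have "ell_norm p (op_of_rows fs x) \<le> (\<Sum>i<length fs. norm (fs ! i)) * norm x" for x
    unfolding op_of_rows_def sum_distrib_right
    by (rule order_trans[OF ell_norm_trunc_le[OF p] sum_mono[OF norm_blinfun]])
  moreover have "op_of_rows fs x \<in> q.span ((\<lambda>i j. if j = i then 1 else 0) ` {..<length fs})" for x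
  proof -
    have "op_of_rows fs x =
        (\<Sum>i<length fs. seq_scale (blinfun_apply (fs ! i) x) (\<lambda>j. if j = i then 1 else 0))"
    proof
      fix j
      have "(\<Sum>i<length fs. seq_scale (blinfun_apply (fs ! i) x) (\<lambda>j. if j = i then 1 else 0)) j
          = (\<Sum>i<length fs. if j = i then blinfun_apply (fs ! i) x else 0)"
        unfolding sum_apply seq_scale_def by (intro sum.cong) auto
      also have "\<dots> = op_of_rows fs x j" by (simp add: op_of_rows_def trunc_def)
      finally show "op_of_rows fs x j = (\<Sum>i<length fs.
          seq_scale (blinfun_apply (fs ! i) x) (\<lambda>j. if j = i then 1 else 0)) j" ..
    qed
    then show ?thesis
      by (simp only:) (intro q.span_sum q.span_scale q.span_base imageI)
  qed
  ultimately show ?thesis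
    unfolding finite_rank_ops_def bounded_ops_def
    by (auto intro!: exI[of _ "(\<lambda>i j. if j = i then 1 else 0) ` {..<length fs}"])
qed

text \<open>A coordinate is dominated by the norm of the sequence, hence is a bounded functional.
  The factor \<open>a\<close> is there to obtain the rows of \<open>2 P\<^sub>n T\<close>.\<close>

lemma coordinate_in_dual:
  fixes sc :: "'k::{real_normed_field, banach} \<Rightarrow> 'a::banach \<Rightarrow> 'a"
  assumes sc: "banach_over sc" and p: "0 < p" and T: "T \<in> bounded_ops sc p"
  obtains f where "f \<in> dual sc" "\<And>x. blinfun_apply f x = a * T x i"
proof -
  interpret banach_over sc by (fact sc)
  obtain C where C: "\<And>x. ell_norm p (T x) \<le> C * norm x"
    using T by (auto simp: bounded_ops_def)
  have "bounded_linear (\<lambda>x. a * T x i)"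
  proof (rule bounded_linear_intro)
    fix x y :: 'a and r :: real
    show "a * T (x + y) i = a * T x i + a * T y i"
      by (simp add: bounded_opsD(2)[OF T] distrib_left)
    \<comment> \<open>Bounded linear maps are real-linear, so only scalars \<open>of_real r\<close>
      matter here; linearity over \<open>'k\<close> is checked separately below.\<close>
    show "a * T (r *\<^sub>R x) i = r *\<^sub>R (a * T x i)"
      using bounded_opsD(3)[OF T, of "of_real r" x]
      by (simp add: scale_of_real seq_scale_def scaleR_conv_of_real)
    have "norm (T x i) \<le> C * norm x"
      using norm_le_ell_norm[OF p bounded_opsD(1)[OF T]] C order_trans by blast
    then show "norm (a * T x i) \<le> norm x * (norm a * C)"
      using mult_left_mono[of "norm (T x i)" "C * norm x" "norm a"]
      by (simp add: norm_mult mult_ac)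
  qed
  then have "blinfun_apply (Blinfun (\<lambda>x. a * T x i)) = (\<lambda>x. a * T x i)"
    by (rule bounded_linear_Blinfun_apply)
  moreover have "Vector_Spaces.linear sc (*) (\<lambda>x. a * T x i)"
    unfolding Vector_Spaces.linear_iff bounded_opsD(2,3)[OF T] seq_scale_def plus_fun_apply
    by (intro conjI allI vector_space_axioms vector_space_over_itself.vector_space_axioms)
      (simp_all add: distrib_left mult.left_commute)
  ultimately show ?thesis using that[of "Blinfun (\<lambda>x. a * T x i)"] by (simp add: dual_def)
qed

text \<open>The constants are \<open>9/8 = 1 + 1/8\<close> and \<open>13/8 = 2 * 7/8 - 1/8\<close>,
  where \<open>1/8\<close> is the error of the perturbed rows. Their gap \<open>1/2\<close> exceeds
  \<open>1/4\<close>, which puts \<open>T\<close> inside the ball of radius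
  \<open>op_norm p S - 1/4\<close> about the centre \<open>S\<close>.\<close>

lemma exists_centre:
  fixes sc :: "'k::{real_normed_field, banach} \<Rightarrow> 'a::banach \<Rightarrow> 'a"
  assumes sc: "banach_over sc" and p: "1 \<le> p"
    and T: "T \<in> bounded_ops sc p" "op_norm p T = 1"
    and D: "D \<subseteq> dual sc" "\<And>f e. f \<in> dual sc \<Longrightarrow> 0 < e \<Longrightarrow> \<exists>g\<in>D. dist g f < e"
  obtains fs where "set fs \<subseteq> D" "op_norm p (T - op_of_rows fs) \<le> 9/8"
    "13/8 < op_norm p (op_of_rows fs)"
proof -
  have p0: "0 < p" using p by simp
  have "\<exists>x. norm x \<le> 1 \<and> 7/8 < ell_norm p (T x)"
    using op_norm_least[of p T "7/8"] T(2) by force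
  then obtain x where x: "norm x \<le> 1" "7/8 < ell_norm p (T x)" by blast
  have "\<forall>\<^sub>F n in sequentially. 7/8 < ell_norm p (trunc n (T x))"
    by (rule order_tendstoD(1)[OF ell_norm_trunc_tendsto[OF p0 bounded_opsD(1)[OF T(1)]] x(2)])
  then obtain n where n: "7/8 < ell_norm p (trunc n (T x))"
    by (auto dest: eventually_happens)
  \<comment> \<open>The tolerance makes the errors of \<open>n\<close> rows add up to at most
    \<open>1/8\<close>; \<open>n + 1\<close> keeps it positive for \<open>n = 0\<close>.\<close>
  have "\<exists>g\<in>D. \<forall>x. norm x \<le> 1 \<longrightarrow> norm (2 * T x i - blinfun_apply g x) \<le> 1 / (8 * (real n + 1))"
    for i
  proof -
    obtain f where f: "f \<in> dual sc" "\<And>x. blinfun_apply f x = 2 * T x i"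
      using coordinate_in_dual[OF sc p0 T(1), where a = 2] by metis
    obtain g where g: "g \<in> D" "dist g f < 1 / (8 * (real n + 1))"
      using D(2)[OF f(1), of "1 / (8 * (real n + 1))"] by auto
    have "norm (2 * T x i - blinfun_apply g x) \<le> 1 / (8 * (real n + 1))" if "norm x \<le> 1" for x
    proof -
      have "norm (blinfun_apply (f - g) x) \<le> norm (f - g) * 1"
        by (rule order_trans[OF norm_blinfun mult_left_mono[OF that norm_ge_zero]])
      then show ?thesis using f(2) g(2) by (simp add: blinfun.diff_left dist_norm norm_minus_commute)
    qed
    with g(1) show ?thesis by blast
  qed
  then obtain g where g: "\<And>i. g i \<in> D"
    "\<And>i x. norm x \<le> 1 \<Longrightarrow> norm (2 * T x i - blinfun_apply (g i) x) \<le> 1 / (8 * (real n + 1))"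
    by metis
  define S where "S = op_of_rows (map g [0..<n])"
  have S: "S x = trunc n (\<lambda>i. blinfun_apply (g i) x)" for x
    by (auto simp: S_def op_of_rows_def trunc_def fun_eq_iff)
  have S_bd: "S \<in> bounded_ops sc p"
    using op_of_rows_finite_rank[OF sc p, of "map g [0..<n]"] g(1) D(1)
    by (auto simp: S_def finite_rank_ops_def)
  have err: "ell_norm p (trunc n (\<lambda>i. 2 * T x i) - S x) \<le> 1/8" if "norm x \<le> 1" for x
  proof -
    have "trunc n (\<lambda>i. 2 * T x i) - S x = trunc n (\<lambda>i. 2 * T x i - blinfun_apply (g i) x)"
      by (auto simp: S trunc_def fun_eq_iff)
    then have "ell_norm p (trunc n (\<lambda>i. 2 * T x i) - S x)
        \<le> (\<Sum>i<n. norm (2 * T x i - blinfun_apply (g i) x))"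
      using ell_norm_trunc_le[OF p] by metis
    also have "\<dots> \<le> (\<Sum>i<n. 1 / (8 * (real n + 1)))" by (intro sum_mono g(2) that)
    also have "\<dots> \<le> 1/8" by (simp add: field_simps)
    finally show ?thesis .
  qed
  have err_ell: "trunc n (\<lambda>i. 2 * T x i) - S x \<in> ell p" for x
    by (rule ell_norm_diff(1)[OF p]) (auto simp: S trunc_in_ell)
  have "op_norm p (T - S) \<le> 9/8"
  proof (rule op_norm_least)
    fix x :: 'a assume x: "norm x \<le> 1"
    let ?u = "T x - trunc n (\<lambda>i. 2 * T x i)"
    \<comment> \<open>\<open>?u\<close> is \<open>T x\<close> with the signs of the first
      \<open>n\<close> coordinates flipped.\<close>
    have flip: "norm (?u i) = norm (T x i)" for i
      by (simp add: trunc_def norm_minus_commute)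
    have "?u \<in> ell p" "ell_norm p ?u \<le> 1"
      using ell_mono[of p "T x" ?u] p0 bounded_opsD(1)[OF T(1)] flip
        op_norm_upper[OF T(1) x] T(2) by auto
    then have "ell_norm p (?u + (trunc n (\<lambda>i. 2 * T x i) - S x)) \<le> 1 + 1/8"
      using ell_norm_triangle(2)[OF p, of ?u "trunc n (\<lambda>i. 2 * T x i) - S x"] err[OF x] err_ell
      by fastforce
    then show "ell_norm p ((T - S) x) \<le> 9/8" by simp
  qed
  \<comment> \<open>Evaluated at the vector \<open>x\<close> chosen at the start, where the
    truncation of \<open>T x\<close> has norm above \<open>7/8\<close>.\<close>
  moreover have "13/8 < op_norm p S"
  proof -
    have "(\<lambda>i. norm (trunc n (\<lambda>i. 2 * T x i) i) powr p)
        = (\<lambda>i. 2 powr p * norm (trunc n (T x) i) powr p)"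
      by (auto simp: trunc_def norm_mult powr_mult fun_eq_iff)
    then have "ell_norm p (trunc n (\<lambda>i. 2 * T x i)) = 2 * ell_norm p (trunc n (T x))"
      using p0 trunc_in_ell[of n "T x" p]
      by (simp add: ell_norm_def ell_def suminf_mult suminf_nonneg powr_mult powr_powr)
    moreover have "ell_norm p (trunc n (\<lambda>i. 2 * T x i))
        \<le> ell_norm p (trunc n (\<lambda>i. 2 * T x i) - S x) + ell_norm p (S x)"
      using ell_norm_triangle(2)[OF p err_ell[of x] bounded_opsD(1)[OF S_bd, of x]] by simp
    ultimately show ?thesis
      using n err[OF x(1)] op_norm_upper[OF S_bd x(1)] by linarith
  qed
  moreover have "set (map g [0..<n]) \<subseteq> D" using g(1) by auto
  ultimately show ?thesis using that[of "map g [0..<n]"] unfolding S_def by blast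
qed

section \<open>The countable family of balls\<close>

theorem theorem3p1:
  fixes sc :: "'k::{real_normed_field, banach} \<Rightarrow> 'a::banach \<Rightarrow> 'a"
    and p :: real
    and E :: "('a \<Rightarrow> nat \<Rightarrow> 'k) set"
  assumes "banach_over sc"
    and "separable_space (top_of_set (dual sc))"
    and "1 < p"
    and "module.subspace op_scale E"
    and "E \<subseteq> bounded_ops sc p"
    and "finite_rank_ops sc p \<subseteq> E"
  shows "UBCP E (op_norm p)"
proof -
  interpret o: vector_space "op_scale :: 'k \<Rightarrow> ('a \<Rightarrow> nat \<Rightarrow> 'k) \<Rightarrow> _" by (rule vector_space_op_scale)
  have p: "1 \<le> p" using assms(3) by simp
  have bd: "T \<in> bounded_ops sc p" if "T \<in> E" for T using that assms(5) by blast
  have diff: "S - T \<in> E" if "S \<in> E" "T \<in> E" for S T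
    using that assms(4) o.subspace_diff by blast
  have zero: "0 \<in> E" using assms(4) o.subspace_0 by blast
  obtain D where D: "countable D" "D \<subseteq> dual sc" "top_of_set (dual sc) closure_of D = dual sc"
    using assms(2) by (auto simp: separable_space_def)
  have dense: "\<exists>g\<in>D. dist g f < e" if "f \<in> dual sc" "0 < e" for f e
  proof -
    \<comment> \<open>The closure relative to the dual is passed to the whole space, where it is
      described by distances.\<close>
    have "f \<in> closure (dual sc \<inter> D)"
      using D(3) that(1) by (metis IntD2 closure_of_subtopology euclidean_closure_of)
    then have "f \<in> closure D" by (rule rev_subsetD[OF _ closure_mono]) simp
    then show ?thesis using that by (auto simp: closure_approachable)
  qed
  \<comment> \<open>The lower bound makes the radii \<open>op_norm p S - 1/4\<close> positive, the
    upper one keeps them bounded.\<close>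
  define A where "A = {S \<in> op_of_rows ` lists D. 1/4 < op_norm p S \<and> op_norm p S \<le> 3}"
  let ?\<B> = "(\<lambda>S. (S, op_norm p S - 1/4)) ` A"
  \<comment> \<open>Rows are kept in finite lists, and a countable \<open>D\<close> has only
    countably many of these.\<close>
  have B: "countable ?\<B>" unfolding A_def
    using D(1) by (intro countable_image countable_Collect countable_lists)
  have A: "S \<in> E" if "S \<in> A" for S
    using that op_of_rows_finite_rank[OF assms(1) p] D(2) assms(6)
    by (fastforce simp: A_def lists_eq_set)
  have cover: "\<exists>S\<in>A. T \<in> nball E (op_norm p) S (op_norm p S - 1/4)"
    if T: "T \<in> E" "op_norm p T = 1" for T
  proof -
    obtain fs where fs: "set fs \<subseteq> D" "op_norm p (T - op_of_rows fs) \<le> 9/8"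
      "13/8 < op_norm p (op_of_rows fs)"
      using exists_centre[OF assms(1) p bd[OF T(1)] T(2) D(2) dense] by blast
    let ?S = "op_of_rows fs"
    have S: "?S \<in> E" using op_of_rows_finite_rank[OF assms(1) p] fs(1) D(2) assms(6) by blast
    \<comment> \<open>This gives at most \<open>1 + 9/8\<close>, so the bound 3 in \<open>A\<close>
      holds.\<close>
    have "op_norm p ?S \<le> op_norm p T + op_norm p (T - ?S)"
      using op_norm_diff[OF p bd[OF T(1)] bd[OF diff[OF T(1) S]]] by simp
    then have "?S \<in> A" using fs T by (auto simp: A_def lists_eq_set)
    moreover have "T \<in> nball E (op_norm p) ?S (op_norm p ?S - 1/4)"
      using fs T by (simp add: nball_def)
    ultimately show ?thesis by blast
  qed
  \<comment> \<open>A common point \<open>T\<close> would give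
    \<open>op_norm p S < 1/4 + (op_norm p S - 1/4)\<close>.\<close>
  have disj: "nball E (op_norm p) S (op_norm p S - 1/4) \<inter> nball E (op_norm p) 0 (1/4) = {}"
    if "S \<in> A" for S
  proof -
    have "op_norm p S \<le> op_norm p T + op_norm p (T - S)" if "T \<in> E" for T
      using op_norm_diff[OF p bd[OF that] bd[OF diff[OF that A[OF \<open>S \<in> A\<close>]]]] by simp
    then show ?thesis by (force simp: nball_def)
  qed
  have zero_ball: "0 \<in> nball E (op_norm p) 0 (1/4)"
  proof -
    have "op_norm p (0 :: 'a \<Rightarrow> nat \<Rightarrow> 'k) \<le> 0"
      using p by (intro op_norm_least) (simp add: ell_norm_def)
    then show ?thesis using zero by (simp add: nball_def)
  qed
  note B
  moreover have "{T \<in> E. op_norm p T = 1} \<subseteq> (\<Union>(c, r)\<in>?\<B>. nball E (op_norm p) c r)"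
    using cover by fastforce
  moreover have "\<forall>(c, r)\<in>?\<B>. c \<in> E \<and> 0 < r" "\<forall>(c, r)\<in>?\<B>. r \<le> 3"
    using A by (auto simp: A_def)
  moreover have "\<forall>(c, r)\<in>?\<B>. nball E (op_norm p) c r \<inter> nball E (op_norm p) 0 (1/4) = {}"
    using disj by simp
  moreover from this have "\<forall>(c, r)\<in>?\<B>. 0 \<notin> nball E (op_norm p) c r"
    using zero_ball by blast
  moreover have "\<exists>c\<^sub>0\<in>E. \<exists>r\<^sub>0>0. 0 \<in> nball E (op_norm p) c\<^sub>0 r\<^sub>0 \<and>
      (\<forall>(c, r)\<in>?\<B>. nball E (op_norm p) c r \<inter> nball E (op_norm p) c\<^sub>0 r\<^sub>0 = {})"
    by (rule bexI[OF _ zero], rule exI[of _ "1/4"]) (use zero_ball disj in simp)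
  ultimately show ?thesis
    unfolding UBCP_def by (intro exI[of _ ?\<B>] conjI exI[of _ 3])
qed

end
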